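(* Let $G$ be a locally compact abelian group. If $\varphi\in C_{ud}(G)$ and $\hat e\notin sp_{w_\varphi}(\varphi)$, then $\varphi$ is bounded.
   Context: $G$ is written additively and equipped with Haar measure. $\widehat{G}$ is the dual group with unit $\hat e$ and action $(x,\gamma)=\gamma(x)$. $\hat f(\gamma)=\int_G f(x)(-x,\gamma)\,dx$ and $f^*(x)=\overline{f(-x)}$ for $f\in L^1(G)$. $\Delta_h\varphi(x)=\varphi(x+h)-\varphi(x)$. $C_u(G)$ is the space of uniformly continuous functions $G\to\mathbb{C}$, $C_{ub}(G)=C_u(G)\cap L^\infty(G)$, and $C_{ud}(G)=\{\varphi\in C_u(G):\Delta_h\varphi\in C_{ub}(G)\text{ for all }h\in G\}$. For $\varphi\in C_{ud}(G)$ define $w_\varphi(y)=1+\tfrac12(\|\Delta_y\varphi\|_\infty+\|\Delta_{-y}\varphi\|_\infty)$, $y\in G$; this $w_\varphi$ is a weight function (locally bounded, $w_\varphi\ge1$, $w_\varphi(x+y)\le w_\varphi(x)w_\varphi(y)$), and $\varphi\in L^\infty_{w_\varphi}(G)$, where for a weight $w$, $L^\infty_w(G)$ is the set of locally bounded measurable $\varphi:G\to\mathbb{C}$ with $\operatorname{ess\,sup}_x|\varphi(x)|/w(x)<\infty$. $L^1_w(G)=\{f\in L^1(G):\int_G|f|w\,dx<\infty\}$. For $\varphi\in L^\infty_w(G)$, with $f^**\varphi(x)=\int_G f^*(x-y)\varphi(y)\,dy$, $sp_w(\varphi)=\{\gamma\in\widehat G:\hat f(\gamma)=0\text{ for all }f\in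 L^1_w(G)\text{ with }f^**\varphi=0\}$. *)

theory Defs
  imports "HOL-Probability.Essential_Supremum"
begin

text \<open>
  A locally compact abelian group is a type \<open>'a::{topological_ab_group_add, t2_space}\<close>
  with \<open>locally compact UNIV\<close>.  A Haar measure on it is a nonzero translation invariant
  Borel measure that is finite on compact sets, outer regular on Borel sets and inner regular
  on open sets.  It need not be \<open>\<sigma>\<close>-finite.
\<close>

definition haar_measure :: "'a::{topological_ab_group_add, t2_space} measure \<Rightarrow> bool" where
  "haar_measure M \<longleftrightarrow>
     sets M = sets borel \<and>
     emeasure M UNIV \<noteq> 0 \<and>
     (\<forall>a. \<forall>A\<in>sets borel. emeasure M ((\<lambda>x. a + x) ` A) = emeasure M A) \<and>
     (\<forall>K. compact K \<longrightarrow> emeasure M K < \<infinity>) \<and>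
     (\<forall>A\<in>sets borel. emeasure M A = (INF U\<in>{U. open U \<and> A \<subseteq> U}. emeasure M U)) \<and>
     (\<forall>U. open U \<longrightarrow> emeasure M U = (SUP K\<in>{K. compact K \<and> K \<subseteq> U}. emeasure M K))"

definition dual_group :: "('a::topological_ab_group_add \<Rightarrow> complex) set" where
  "dual_group = {\<gamma>. continuous_on UNIV \<gamma> \<and> (\<forall>x. norm (\<gamma> x) = 1) \<and>
                    (\<forall>x y. \<gamma> (x + y) = \<gamma> x * \<gamma> y)}"

definition dual_unit :: "'a \<Rightarrow> complex" where
  "dual_unit = (\<lambda>x. 1)"

definition diff_op :: "'a::plus \<Rightarrow> ('a \<Rightarrow> complex) \<Rightarrow> 'a \<Rightarrow> complex" where
  "diff_op h \<phi> = (\<lambda>x. \<phi> (x + h) - \<phi> x)"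

definition ess_norm :: "'a measure \<Rightarrow> ('a \<Rightarrow> complex) \<Rightarrow> ereal" where
  "ess_norm M f = esssup M (\<lambda>x. ereal (norm (f x)))"

definition Linf :: "'a measure \<Rightarrow> ('a \<Rightarrow> complex) set" where
  "Linf M = {f. f \<in> borel_measurable M \<and> ess_norm M f < \<infinity>}"

definition Linf_norm :: "'a measure \<Rightarrow> ('a \<Rightarrow> complex) \<Rightarrow> real" where
  "Linf_norm M f = real_of_ereal (ess_norm M f)"

text \<open>
  Uniform continuity refers to the uniformity of the group; the library's
  \<^const>\<open>uniformly_continuous_on\<close> needs a \<^class>\<open>uniform_space\<close> and does not apply.
\<close>

definition C_u :: "('a::topological_ab_group_add \<Rightarrow> complex) set" where
  "C_u = {\<phi>. \<forall>\<epsilon>>0. \<exists>U. open U \<and> 0 \<in> U \<and> (\<forall>x y. x - y \<in> U \<longrightarrow> norm (\<phi> x - \<phi> y) < \<epsilon>)}"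

definition C_ub :: "'a::topological_ab_group_add measure \<Rightarrow> ('a \<Rightarrow> complex) set" where
  "C_ub M = C_u \<inter> Linf M"

definition C_ud :: "'a::topological_ab_group_add measure \<Rightarrow> ('a \<Rightarrow> complex) set" where
  "C_ud M = {\<phi> \<in> C_u. \<forall>h. diff_op h \<phi> \<in> C_ub M}"

definition weight_of :: "'a::topological_ab_group_add measure \<Rightarrow> ('a \<Rightarrow> complex) \<Rightarrow> 'a \<Rightarrow> real" where
  "weight_of M \<phi> y = 1 + 1/2 * (Linf_norm M (diff_op y \<phi>) + Linf_norm M (diff_op (- y) \<phi>))"

definition L1 :: "'a measure \<Rightarrow> ('a \<Rightarrow> complex) set" where
  "L1 M = {f. integrable M f}"

definition L1_w :: "'a measure \<Rightarrow> ('a \<Rightarrow> real) \<Rightarrow> ('a \<Rightarrow> complex) set" where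
  "L1_w M w = {f \<in> L1 M. (\<integral>\<^sup>+x. ennreal (norm (f x) * w x) \<partial>M) < \<infinity>}"

definition fourier :: "'a::uminus measure \<Rightarrow> ('a \<Rightarrow> complex) \<Rightarrow> ('a \<Rightarrow> complex) \<Rightarrow> complex" where
  "fourier M f \<gamma> = (\<integral>x. f x * \<gamma> (- x) \<partial>M)"

definition star_fun :: "('a::uminus \<Rightarrow> complex) \<Rightarrow> 'a \<Rightarrow> complex" where
  "star_fun f x = cnj (f (- x))"

definition convolution ::
    "'a::minus measure \<Rightarrow> ('a \<Rightarrow> complex) \<Rightarrow> ('a \<Rightarrow> complex) \<Rightarrow> 'a \<Rightarrow> complex" where
  "convolution M g \<phi> x = (\<integral>y. g (x - y) * \<phi> y \<partial>M)"

text \<open>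
  Intended for \<open>\<phi>\<close> in the weighted space \<open>L\<^sup>\<infinity>\<^sub>w\<close>, where the convolution integral
  converges at every point to a continuous function of \<open>x\<close>; so it vanishes everywhere iff it
  vanishes almost everywhere.
\<close>

definition spec_w ::
    "'a::topological_ab_group_add measure \<Rightarrow> ('a \<Rightarrow> real) \<Rightarrow> ('a \<Rightarrow> complex) \<Rightarrow> ('a \<Rightarrow> complex) set" where
  "spec_w M w \<phi> = {\<gamma> \<in> dual_group. \<forall>f \<in> L1_w M w.
     (\<forall>x. convolution M (star_fun f) \<phi> x = 0) \<longrightarrow> fourier M f \<gamma> = 0}"

end

theory Submission
  imports Defs
begin

text \<open>
  Take \<open>f\<close> in the weighted \<open>L\<^sup>1\<close> space with \<open>f\<^sup>* * \<phi> = 0\<close> and \<open>\<integral>f \<noteq> 0\<close>.  Since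
  \<open>(f\<^sup>* * \<phi>)(x) = \<integral>cnj (f y) \<phi>(x + y) dy\<close>, writing
  \<open>\<phi>(x + y) = \<phi>(x) + \<Delta>\<^sub>y\<phi>(x)\<close> gives
  \<open>\<phi>(x) \<integral>cnj (f y) dy = - \<integral>cnj (f y) \<Delta>\<^sub>y\<phi>(x) dy\<close>.  The right-hand side is bounded by
  \<open>2 \<integral>|f| w\<^sub>\<phi>\<close> uniformly in \<open>x\<close>.
\<close>

lemma C_u_continuous:
  fixes \<phi> :: "'a::topological_ab_group_add \<Rightarrow> complex"
  assumes "\<phi> \<in> C_u"
  shows "continuous_on UNIV \<phi>"
proof -
  have "(\<phi> \<longlongrightarrow> \<phi> x) (at x)" for x
  proof (rule tendstoI)
    fix e :: real assume "e > 0"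
    then obtain U where U: "open U" "0 \<in> U" "\<And>x y. x - y \<in> U \<Longrightarrow> norm (\<phi> x - \<phi> y) < e"
      using assms unfolding C_u_def by blast
    have "open ((\<lambda>y. y - x) -` U)"
      by (intro open_vimage U continuous_intros)
    moreover have "x \<in> (\<lambda>y. y - x) -` U" using U by simp
    ultimately have "\<forall>\<^sub>F y in at x. y \<in> (\<lambda>y. y - x) -` U"
      by (rule eventually_at_in_open')
    then show "\<forall>\<^sub>F y in at x. dist (\<phi> y) (\<phi> x) < e"
      by (rule eventually_mono) (use U in \<open>auto simp: dist_norm\<close>)
  qed
  then show ?thesis by (simp add: continuous_on_def)
qed

text \<open>The preimage form gives openness of a translate of an open set directly from
  continuity.\<close>

lemma translation_eq_vimage:
  fixes a :: "'a::ab_group_add"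
  shows "(\<lambda>x. a + x) ` A = (\<lambda>x. x - a) -` A"
proof (intro set_eqI iffI)
  fix z assume "z \<in> (\<lambda>x. x - a) -` A"
  then have "a + (z - a) \<in> (\<lambda>x. a + x) ` A" by (intro imageI) simp
  then show "z \<in> (\<lambda>x. a + x) ` A" by simp
qed auto

lemma haar_measure_sets: "haar_measure M \<Longrightarrow> sets M = sets borel"
  by (simp add: haar_measure_def)

lemma haar_measure_space: "haar_measure M \<Longrightarrow> space M = UNIV"
  using sets_eq_imp_space_eq[of M borel] by (simp add: haar_measure_def)

lemma haar_measure_measurable: "haar_measure M \<Longrightarrow> measurable M N = measurable borel N"
  by (rule measurable_cong_sets) (simp_all add: haar_measure_sets)

lemma haar_measure_translate:
  fixes M :: "'a::{topological_ab_group_add, t2_space} measure"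
  assumes "haar_measure M" "A \<in> sets borel"
  shows "emeasure M ((\<lambda>x. a + x) ` A) = emeasure M A"
  using assms by (simp add: haar_measure_def)

text \<open>If \<open>U\<close> were null, finitely many of its translates, all null, would cover
  any given compact set. Every compact set would then be null, and inner regularity on the open set
  \<open>UNIV\<close> would force \<open>M\<close> to vanish.\<close>

lemma haar_measure_open_pos:
  fixes M :: "'a::{topological_ab_group_add, t2_space} measure"
  assumes M: "haar_measure M" and U: "open U" "U \<noteq> {}"
  shows "emeasure M U \<noteq> 0"
proof
  assume null: "emeasure M U = 0"
  obtain u where u: "u \<in> U" using U by blast
  have opn: "open ((\<lambda>x. a + x) ` U)" for a
    unfolding translation_eq_vimage by (intro open_vimage U continuous_intros)
  have "emeasure M K = 0" if K: "compact K" for K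
  proof -
    \<comment> \<open>Translation by \<open>k - u\<close> carries \<open>u\<close> to
      \<open>k\<close>, so the translate indexed by \<open>k\<close> contains
      \<open>k\<close>.\<close>
    have "K \<subseteq> (\<Union>k\<in>K. (\<lambda>x. (k - u) + x) ` U)"
      using u by (auto simp: translation_eq_vimage)
    then obtain F where F: "F \<subseteq> K" "finite F" "K \<subseteq> (\<Union>k\<in>F. (\<lambda>x. (k - u) + x) ` U)"
      using compactE_image[OF K, of K "\<lambda>k. (\<lambda>x. (k - u) + x) ` U"] opn by metis
    have "(\<lambda>x. (k - u) + x) ` U \<in> null_sets M" for k
      using haar_measure_translate[OF M, of U "k - u"] null U opn haar_measure_sets[OF M]
      by (auto intro!: null_setsI)
    then have "(\<Union>k\<in>F. (\<lambda>x. (k - u) + x) ` U) \<in> null_sets M"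
      using F(2) by (intro null_sets_UN' countable_finite) auto
    then show ?thesis using F(3) emeasure_mono[OF F(3), of M] by (auto simp: null_sets_def)
  qed
  moreover have "emeasure M UNIV = (SUP K\<in>{K. compact K \<and> K \<subseteq> UNIV}. emeasure M K)"
    using M open_UNIV unfolding haar_measure_def by metis
  ultimately have "emeasure M UNIV \<le> 0"
    by (metis (mono_tags, lifting) SUP_least mem_Collect_eq order_refl)
  then show False using M unfolding haar_measure_def by auto
qed

text \<open>The set where \<open>norm (g y)\<close> exceeds the essential supremum is open by
  continuity and null, hence empty. This replaces an almost-everywhere bound, whose exceptional set
  could vary with \<open>g\<close>, by one valid at every point.\<close>

lemma norm_le_Linf_norm:
  fixes M :: "'a::{topological_ab_group_add, t2_space} measure"
  assumes M: "haar_measure M" and g: "continuous_on UNIV g" "g \<in> Linf M"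
  shows "norm (g x) \<le> Linf_norm M g"
proof -
  have le: "ereal (norm (g x)) \<le> ess_norm M g" for x
  proof (rule ccontr)
    assume *: "\<not> ereal (norm (g x)) \<le> ess_norm M g"
    let ?V = "{y. ess_norm M g < ereal (norm (g y))}"
    have "open ?V"
      by (intro open_Collect_less continuous_intros continuous_on_ereal g)
    moreover have "AE y in M. ereal (norm (g y)) \<le> ess_norm M g"
      unfolding ess_norm_def by (rule esssup_AE)
    then have "emeasure M ?V = 0"
      using \<open>open ?V\<close> haar_measure_sets[OF M] haar_measure_space[OF M]
      by (subst (asm) AE_iff_measurable[of ?V]) (auto simp: not_le)
    ultimately show False using haar_measure_open_pos[OF M, of ?V] * by (auto simp: not_le)
  qed
  \<comment> \<open>\<open>real_of_ereal\<close> sends both infinities to 0. Membership in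
    \<open>Linf\<close> excludes plus infinity, and the bound \<open>le\<close> excludes minus
    infinity.\<close>
  moreover have "ess_norm M g < \<infinity>" using g by (simp add: Linf_def)
  ultimately show ?thesis
    using le[of x] unfolding Linf_norm_def by (cases "ess_norm M g") auto
qed

lemma haar_measure_distr:
  fixes M :: "'a::{topological_ab_group_add, t2_space} measure"
  assumes M: "haar_measure M"
  shows "distr M M (\<lambda>y. a + y) = M"
proof (rule measure_eqI)
  fix A assume "A \<in> sets (distr M M (\<lambda>y. a + y))"
  then have A: "A \<in> sets borel" using haar_measure_sets[OF M] by simp
  have "(\<lambda>y. a + y) \<in> borel \<rightarrow>\<^sub>M borel"
    by (intro borel_measurable_continuous_onI continuous_intros)
  then have T: "(\<lambda>y. a + y) \<in> M \<rightarrow>\<^sub>M M"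
    using measurable_cong_sets[OF haar_measure_sets[OF M] haar_measure_sets[OF M]] by simp
  have eq: "(\<lambda>y. a + y) -` A = (\<lambda>y. - a + y) ` A"
    unfolding translation_eq_vimage by (simp add: add.commute)
  show "emeasure (distr M M (\<lambda>y. a + y)) A = emeasure M A"
    using A T haar_measure_sets[OF M] haar_measure_space[OF M] haar_measure_translate[OF M A, of "- a"]
    by (simp add: emeasure_distr eq del: uminus_add_conv_diff)
qed simp

lemma borel_measurable_cnj:
  "f \<in> borel_measurable M \<Longrightarrow> (\<lambda>x. cnj (f x)) \<in> borel_measurable M"
  by (rule borel_measurable_continuous_on[OF continuous_on_cnj[OF continuous_on_id]])

text \<open>Translation invariance allows \<open>x + y\<close> in place of \<open>y\<close>, and the
  argument of \<open>star_fun f\<close> becomes \<open>- y\<close>. The result has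
  \<open>\<phi> (x + y)\<close> in the integrand, ready to be compared with
  \<open>\<phi> x\<close>.\<close>

lemma convolution_star_fun:
  fixes M :: "'a::{topological_ab_group_add, t2_space} measure"
  assumes M: "haar_measure M" and f: "f \<in> borel_measurable M" and \<phi>: "\<phi> \<in> borel_measurable M"
  shows "convolution M (star_fun f) \<phi> x = (\<integral>y. cnj (f y) * \<phi> (x + y) \<partial>M)"
proof -
  note cong = measurable_cong_sets[OF haar_measure_sets[OF M] haar_measure_sets[OF M]]
  have T: "(\<lambda>y. x + y) \<in> M \<rightarrow>\<^sub>M M"
    unfolding cong by (intro borel_measurable_continuous_onI continuous_intros)
  have "(\<lambda>y. y - x) \<in> M \<rightarrow>\<^sub>M M"
    unfolding cong by (intro borel_measurable_continuous_onI continuous_intros)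
  then have fx: "(\<lambda>y. f (y - x)) \<in> borel_measurable M"
    using f by (rule measurable_compose)
  have "(\<integral>y. cnj (f (y - x)) * \<phi> y \<partial>distr M M (\<lambda>y. x + y)) = (\<integral>y. cnj (f y) * \<phi> (x + y) \<partial>M)"
    using fx \<phi> by (subst integral_distr[OF T]) (auto intro!: borel_measurable_times borel_measurable_cnj)
  then show ?thesis
    by (simp add: convolution_def star_fun_def haar_measure_distr[OF M])
qed

theorem theorem5p2:
  fixes M :: "'a::{topological_ab_group_add, t2_space} measure"
    and \<phi> :: "'a \<Rightarrow> complex"
  assumes "locally compact (UNIV :: 'a set)"
    and "haar_measure M"
    and "\<phi> \<in> C_ud M"
    and "dual_unit \<notin> spec_w M (weight_of M \<phi>) \<phi>"
  shows "bounded (range \<phi>)"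
proof -
  define w where "w = weight_of M \<phi>"
  note M = assms(2)
  \<comment> \<open>Since the unit is a character, its absence from the spectrum can only come from
    some \<open>f\<close> violating the vanishing condition.\<close>
  have "dual_unit \<in> (dual_group :: ('a \<Rightarrow> complex) set)"
    by (simp add: dual_group_def dual_unit_def)
  then obtain f where f: "f \<in> L1_w M w" "\<And>x. convolution M (star_fun f) \<phi> x = 0"
      "fourier M f dual_unit \<noteq> 0"
    using assms(4) unfolding spec_w_def w_def by blast
  have int_f: "integrable M f" using f(1) by (simp add: L1_w_def L1_def)
  have meas_f [measurable]: "f \<in> borel_measurable M" using int_f by simp
  have cont: "continuous_on UNIV \<phi>"
    using assms(3) C_u_continuous by (auto simp: C_ud_def)
  have cont_shift: "continuous_on UNIV (\<lambda>y. \<phi> (x + y))" "continuous_on UNIV (\<lambda>y. \<phi> (y + x))" for x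
    by (auto intro!: continuous_on_compose2[OF cont] continuous_intros)
  have norm_diff: "norm (diff_op y \<phi> x) \<le> Linf_norm M (diff_op y \<phi>)" for x y
  proof (rule norm_le_Linf_norm[OF M])
    show "continuous_on UNIV (diff_op y \<phi>)"
      unfolding diff_op_def by (intro continuous_intros cont_shift cont)
  qed (use assms(3) in \<open>auto simp: C_ud_def C_ub_def\<close>)
  have diff_w: "norm (diff_op y \<phi> x) \<le> 2 * w y" for x y
    using norm_diff[of y x] order_trans[OF norm_ge_zero norm_diff, of "- y"]
    by (simp add: w_def weight_of_def field_simps)
  have meas_\<phi> [measurable]: "(\<lambda>y. \<phi> (x + y)) \<in> borel_measurable M" for x
    unfolding haar_measure_measurable[OF M]
    by (intro borel_measurable_continuous_onI cont_shift)
  have meas_\<phi>0: "\<phi> \<in> borel_measurable M" using meas_\<phi>[of 0] by simp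
  define I where "I = enn2real (\<integral>\<^sup>+y. ennreal (norm (f y) * w y) \<partial>M)"
  define g where "g = (\<lambda>x y. cnj (f y) * diff_op y \<phi> x)"
  have meas_g [measurable]: "g x \<in> borel_measurable M" for x
    unfolding g_def diff_op_def
    by (intro borel_measurable_times borel_measurable_diff borel_measurable_cnj meas_f meas_\<phi>) simp
  have I: "(\<integral>\<^sup>+y. ennreal (norm (f y) * w y) \<partial>M) = ennreal I"
    using f(1) unfolding I_def L1_w_def by (simp add: less_top)
  \<comment> \<open>The factor 2 stays on the left because \<open>w\<close> need not be measurable, and then the
    lower integral given by \<open>nn_integral\<close> is only known to be monotone.\<close>
  have nn_g: "(\<integral>\<^sup>+y. ennreal (norm (g x y / 2)) \<partial>M) \<le> ennreal I" for x
    unfolding I[symmetric]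
  proof (intro nn_integral_mono ennreal_leI)
    fix y
    show "norm (g x y / 2) \<le> norm (f y) * w y"
      using mult_left_mono[OF diff_w[of y x], of "norm (f y)"]
      by (simp add: g_def norm_mult norm_divide)
  qed
  have int_g2: "integrable M (\<lambda>y. g x y / 2)" for x
    using nn_g[of x] by (intro integrableI_bounded) (auto intro: le_less_trans)
  then have int_g: "integrable M (g x)" for x
    using integrable_mult_right[OF int_g2[of x], of 2] by simp
  have norm_g: "norm (\<integral>y. g x y \<partial>M) \<le> 2 * I" for x
  proof -
    have "ennreal (norm (\<integral>y. g x y / 2 \<partial>M)) \<le> ennreal I"
      using integral_norm_bound_ennreal[OF int_g2[of x]] nn_g[of x] by (rule order_trans)
    moreover have "0 \<le> I" by (simp add: I_def)
    ultimately have "norm (\<integral>y. g x y / 2 \<partial>M) \<le> I" by simp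
    then show ?thesis by (simp add: norm_divide)
  qed
  \<comment> \<open>At the trivial character the Fourier transform is the plain integral of
    \<open>f\<close>, so \<open>c\<close> is its conjugate and is nonzero.\<close>
  define c where "c = (\<integral>y. cnj (f y) \<partial>M)"
  have "c = cnj (fourier M f dual_unit)"
    by (simp add: c_def fourier_def dual_unit_def)
  then have c: "norm c > 0" using f(3) by simp
  have "norm (\<phi> x) \<le> 2 * I / norm c" for x
  proof -
    have "0 = (\<integral>y. cnj (f y) * \<phi> (x + y) \<partial>M)"
      using convolution_star_fun[OF M meas_f meas_\<phi>0] f(2) by simp
    also have "\<dots> = (\<integral>y. cnj (f y) * \<phi> x + g x y \<partial>M)"
      by (simp add: g_def diff_op_def algebra_simps)
    \<comment> \<open>The integral may be split because both summands are integrable in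
      \<open>y\<close>: the first is \<open>cnj (f y)\<close> times a constant, the second is
      covered by \<open>int_g\<close>.\<close>
    also have "\<dots> = c * \<phi> x + (\<integral>y. g x y \<partial>M)"
      using int_f int_g by (simp add: c_def)
    finally have "c * \<phi> x = - (\<integral>y. g x y \<partial>M)" by (simp add: eq_neg_iff_add_eq_0)
    then have "norm c * norm (\<phi> x) \<le> 2 * I"
      using norm_g[of x] by (metis norm_minus_cancel norm_mult)
    then show ?thesis using c by (simp add: field_simps)
  qed
  then show ?thesis by (auto simp: bounded_iff)
qed

end
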